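(* Let $\mathbb{K}$ be a field of characteristic $0$, $(\mathrm{A},.)$ a Poisson admissible algebra over $\mathbb{K}$ and $\mathrm{U}$ a finite dimensional associative $\mathrm{LR}$-algebra over $\mathbb{K}$. Let $[u,v]=u.v-v.u$ on $\mathrm{A}$. Then the product on $\mathrm{A}\otimes\mathrm{U}$ given by $$(u\otimes a)\star(v\otimes b)=\tfrac12[u,v]\otimes(ab+ba)+\tfrac12\,u.v\otimes(3ab+ba)$$ induces on $\mathrm{A}\otimes\mathrm{U}$ a Poisson admissible algebra structure. Moreover, if "$.$" is strongly quasi-canonical on $(\mathrm{A},[\,,\,])$, then $\star$ is also strongly quasi-canonical on $(\mathrm{A}\otimes\mathrm{U},[\,,\,])$, where the bracket on $\mathrm{A}\otimes\mathrm{U}$ is the commutator of $\star$.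
   Context: An algebra $(\mathrm{U},\cdot)$, with left and right multiplications $\mathrm{L}_ab=ab$, $\mathrm{R}_ab=ba$, is an $\mathrm{LR}$-algebra if $[\mathrm{L}_a,\mathrm{L}_b]=[\mathrm{R}_a,\mathrm{R}_b]=0$ for all $a,b\in\mathrm{U}$. Associative algebras are not assumed unital. A Poisson algebra is a finite dimensional Lie algebra $(\mathfrak{g},[\,,\,])$ endowed with a commutative and associative product $\circ$ such that $[u,v\circ w]=[u,v]\circ w+v\circ[u,w]$. An algebra $(\mathrm{A},.)$ is Poisson admissible if $(\mathrm{A},[\,,\,],\circ)$ is a Poisson algebra, where $[u,v]=u.v-v.u$ and $u\circ v=\frac12(u.v+v.u)$. Let $\mathfrak{g}$ be a finite dimensional Lie algebra and $\alpha$ a bilinear product on $\mathfrak{g}$, with $\mathrm{L}_uv=\alpha(u,v)$ and curvature $K^\alpha(u,v)=[\mathrm{L}_u,\mathrm{L}_v]-\mathrm{L}_{[u,v]}$. The product $\alpha$ is quasi-canonical if it is Lie-admissible ($\alpha(u,v)-\alpha(v,u)=[u,v]$), bi-invariant ($[u,\alpha(v,w)]=\alpha([u,v],w)+\alpha(v,[u,w])$), and $K^\alpha(u,v)=-\frac14\mathrm{ad}_{[u,v]}$, for all $u,v,w$. Its holonomy Lie algebra is then $\mathfrak{h}^\alpha=\mathrm{ad}_{[\mathfrak{g},\mathfrak{g}]}+\mathrm{L}_{[\mathfrak{g},[\mathfrak{g},\mathfrak{g}]]}\subset\mathrm{End}(\mathfrak{g})$, and $\alpha$ is strongly quasi-canonical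 if it is quasi-canonical and $\mathfrak{h}^\alpha=\mathrm{ad}_{[\mathfrak{g},\mathfrak{g}]}$. *)

theory Defs
  imports Complex_Main
begin

definition finite_dimensional :: "('k::field \<Rightarrow> 'v::ab_group_add \<Rightarrow> 'v) \<Rightarrow> bool" where
  "finite_dimensional s \<longleftrightarrow> (\<exists>B. finite_dimensional_vector_space s B)"

text \<open>The predicate \<open>Vector_Spaces.linear\<close> includes the vector space axioms for source and
  target, hence so does \<open>bilinear_map\<close>.\<close>

definition bilinear_map ::
  "('k::field \<Rightarrow> 'u::ab_group_add \<Rightarrow> 'u) \<Rightarrow> ('k \<Rightarrow> 'v::ab_group_add \<Rightarrow> 'v) \<Rightarrow>
   ('k \<Rightarrow> 'w::ab_group_add \<Rightarrow> 'w) \<Rightarrow> ('u \<Rightarrow> 'v \<Rightarrow> 'w) \<Rightarrow> bool" where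
  "bilinear_map s1 s2 s3 f \<longleftrightarrow>
     (\<forall>x. Vector_Spaces.linear s2 s3 (f x)) \<and> (\<forall>y. Vector_Spaces.linear s1 s3 (\<lambda>x. f x y))"

definition algebra_over :: "('k::field \<Rightarrow> 'v::ab_group_add \<Rightarrow> 'v) \<Rightarrow> ('v \<Rightarrow> 'v \<Rightarrow> 'v) \<Rightarrow> bool" where
  "algebra_over s m \<longleftrightarrow> bilinear_map s s s m"

definition left_mult :: "('v \<Rightarrow> 'v \<Rightarrow> 'v) \<Rightarrow> 'v \<Rightarrow> 'v \<Rightarrow> 'v" where
  "left_mult m a = (\<lambda>b. m a b)"

definition right_mult :: "('v \<Rightarrow> 'v \<Rightarrow> 'v) \<Rightarrow> 'v \<Rightarrow> 'v \<Rightarrow> 'v" where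
  "right_mult m a = (\<lambda>b. m b a)"

definition commutator :: "('v::ab_group_add \<Rightarrow> 'v \<Rightarrow> 'v) \<Rightarrow> 'v \<Rightarrow> 'v \<Rightarrow> 'v" where
  "commutator m u v = m u v - m v u"

definition op_commutator :: "('v::ab_group_add \<Rightarrow> 'v) \<Rightarrow> ('v \<Rightarrow> 'v) \<Rightarrow> 'v \<Rightarrow> 'v" where
  "op_commutator f g = (\<lambda>x. f (g x) - g (f x))"

definition associative_algebra ::
  "('k::field \<Rightarrow> 'v::ab_group_add \<Rightarrow> 'v) \<Rightarrow> ('v \<Rightarrow> 'v \<Rightarrow> 'v) \<Rightarrow> bool" where
  "associative_algebra s m \<longleftrightarrow> algebra_over s m \<and> (\<forall>a b c. m (m a b) c = m a (m b c))"

definition LR_algebra ::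
  "('k::field \<Rightarrow> 'v::ab_group_add \<Rightarrow> 'v) \<Rightarrow> ('v \<Rightarrow> 'v \<Rightarrow> 'v) \<Rightarrow> bool" where
  "LR_algebra s m \<longleftrightarrow> algebra_over s m \<and>
     (\<forall>a b. op_commutator (left_mult m a) (left_mult m b) = (\<lambda>_. 0) \<and>
            op_commutator (right_mult m a) (right_mult m b) = (\<lambda>_. 0))"

definition lie_algebra ::
  "('k::field \<Rightarrow> 'v::ab_group_add \<Rightarrow> 'v) \<Rightarrow> ('v \<Rightarrow> 'v \<Rightarrow> 'v) \<Rightarrow> bool" where
  "lie_algebra s br \<longleftrightarrow> algebra_over s br \<and> (\<forall>u. br u u = 0) \<and>
     (\<forall>u v w. br u (br v w) + br v (br w u) + br w (br u v) = 0)"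

definition poisson_algebra ::
  "('k::field \<Rightarrow> 'v::ab_group_add \<Rightarrow> 'v) \<Rightarrow> ('v \<Rightarrow> 'v \<Rightarrow> 'v) \<Rightarrow> ('v \<Rightarrow> 'v \<Rightarrow> 'v) \<Rightarrow> bool" where
  "poisson_algebra s br m \<longleftrightarrow>
     finite_dimensional s \<and> lie_algebra s br \<and>
     associative_algebra s m \<and> (\<forall>u v. m u v = m v u) \<and>
     (\<forall>u v w. br u (m v w) = m (br u v) w + m v (br u w))"

definition sym_product ::
  "('k::field \<Rightarrow> 'v::ab_group_add \<Rightarrow> 'v) \<Rightarrow> ('v \<Rightarrow> 'v \<Rightarrow> 'v) \<Rightarrow> 'v \<Rightarrow> 'v \<Rightarrow> 'v" where
  "sym_product s m u v = s (1/2) (m u v + m v u)"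

definition poisson_admissible ::
  "('k::field \<Rightarrow> 'v::ab_group_add \<Rightarrow> 'v) \<Rightarrow> ('v \<Rightarrow> 'v \<Rightarrow> 'v) \<Rightarrow> bool" where
  "poisson_admissible s m \<longleftrightarrow>
     algebra_over s m \<and> poisson_algebra s (commutator m) (sym_product s m)"

definition curvature ::
  "('v::ab_group_add \<Rightarrow> 'v \<Rightarrow> 'v) \<Rightarrow> ('v \<Rightarrow> 'v \<Rightarrow> 'v) \<Rightarrow> 'v \<Rightarrow> 'v \<Rightarrow> 'v \<Rightarrow> 'v" where
  "curvature br \<alpha> u v =
     (\<lambda>w. op_commutator (left_mult \<alpha> u) (left_mult \<alpha> v) w - left_mult \<alpha> (br u v) w)"

definition quasi_canonical ::
  "('k::field \<Rightarrow> 'v::ab_group_add \<Rightarrow> 'v) \<Rightarrow> ('v \<Rightarrow> 'v \<Rightarrow> 'v) \<Rightarrow> ('v \<Rightarrow> 'v \<Rightarrow> 'v) \<Rightarrow> bool" where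
  "quasi_canonical s br \<alpha> \<longleftrightarrow>
     finite_dimensional s \<and> lie_algebra s br \<and> algebra_over s \<alpha> \<and>
     (\<forall>u v. \<alpha> u v - \<alpha> v u = br u v) \<and>
     (\<forall>u v w. br u (\<alpha> v w) = \<alpha> (br u v) w + \<alpha> v (br u w)) \<and>
     (\<forall>u v. curvature br \<alpha> u v = (\<lambda>w. s (- (1/4)) (left_mult br (br u v) w)))"

definition bracket_span ::
  "('k::field \<Rightarrow> 'v::ab_group_add \<Rightarrow> 'v) \<Rightarrow> ('v \<Rightarrow> 'v \<Rightarrow> 'v) \<Rightarrow> 'v set \<Rightarrow> 'v set \<Rightarrow> 'v set" where
  "bracket_span s br S T = module.span s {br x y | x y. x \<in> S \<and> y \<in> T}"

definition derived_algebra ::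
  "('k::field \<Rightarrow> 'v::ab_group_add \<Rightarrow> 'v) \<Rightarrow> ('v \<Rightarrow> 'v \<Rightarrow> 'v) \<Rightarrow> 'v set" where
  "derived_algebra s br = bracket_span s br UNIV UNIV"

text \<open>The operator \<open>ad\<^sub>u\<close> is \<open>left_mult br u\<close>.\<close>

definition holonomy_algebra ::
  "('k::field \<Rightarrow> 'v::ab_group_add \<Rightarrow> 'v) \<Rightarrow> ('v \<Rightarrow> 'v \<Rightarrow> 'v) \<Rightarrow> ('v \<Rightarrow> 'v \<Rightarrow> 'v) \<Rightarrow> ('v \<Rightarrow> 'v) set" where
  "holonomy_algebra s br \<alpha> =
     {\<lambda>w. left_mult br u w + left_mult \<alpha> v w | u v.
        u \<in> derived_algebra s br \<and> v \<in> bracket_span s br UNIV (derived_algebra s br)}"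

definition strongly_quasi_canonical ::
  "('k::field \<Rightarrow> 'v::ab_group_add \<Rightarrow> 'v) \<Rightarrow> ('v \<Rightarrow> 'v \<Rightarrow> 'v) \<Rightarrow> ('v \<Rightarrow> 'v \<Rightarrow> 'v) \<Rightarrow> bool" where
  "strongly_quasi_canonical s br \<alpha> \<longleftrightarrow>
     quasi_canonical s br \<alpha> \<and>
     holonomy_algebra s br \<alpha> = left_mult br ` derived_algebra s br"

text \<open>\<open>(T, \<otimes>)\<close> is a tensor product of two vector spaces, given by its universal property. A
  definition cannot quantify over all target types, so the property is required for the target
  \<open>K\<close>; the theorem \<open>tensor_product_universal\<close> below derives it for every target vector space.\<close>

definition tensor_product ::
  "('k::field \<Rightarrow> 'u::ab_group_add \<Rightarrow> 'u) \<Rightarrow> ('k \<Rightarrow> 'v::ab_group_add \<Rightarrow> 'v) \<Rightarrow>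
   ('k \<Rightarrow> 't::ab_group_add \<Rightarrow> 't) \<Rightarrow> ('u \<Rightarrow> 'v \<Rightarrow> 't) \<Rightarrow> bool" where
  "tensor_product s1 s2 sT tens \<longleftrightarrow>
     bilinear_map s1 s2 sT tens \<and>
     (\<forall>f. bilinear_map s1 s2 (*) f \<longrightarrow>
        (\<exists>!g. Vector_Spaces.linear sT (*) g \<and> (\<forall>u v. g (tens u v) = f u v)))"

lemma vector_space_field: "vector_space ((*) :: 'k::field \<Rightarrow> 'k \<Rightarrow> 'k)"
  by unfold_locales (auto simp: algebra_simps)

lemma functional_separates:
  assumes "vector_space s" "\<not> module.dependent s B" "x \<notin> module.span s B"
  shows "\<exists>\<phi>. Vector_Spaces.linear s (*) \<phi> \<and> (\<forall>b\<in>B. \<phi> b = 0) \<and> \<phi> x = 1"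
proof -
  interpret vector_space_pair s "(*)"
    using assms(1) vector_space_field by (simp add: vector_space_pair_def)
  have "vs1.independent (insert x B)"
    using assms by (simp add: vs1.independent_insertI)
  then obtain \<phi> where "Vector_Spaces.linear s (*) \<phi>"
      "\<forall>y\<in>insert x B. \<phi> y = (if y = x then 1 else 0)"
    using linear_independent_extend[of "insert x B" "\<lambda>y. if y = x then 1 else 0"] by blast
  moreover have "x \<notin> B" using assms(3) vs1.span_base by blast
  ultimately show ?thesis by (intro exI[of _ \<phi>]) auto
qed

lemma bilinear_map_vector_spaces:
  assumes "bilinear_map s1 s2 s3 f"
  shows "vector_space s1" "vector_space s2" "vector_space s3"
  using assms by (simp_all add: bilinear_map_def Vector_Spaces.linear_def)

lemma tensor_product_bilinear:
  assumes "tensor_product s1 s2 sT tens"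
  shows "bilinear_map s1 s2 sT tens"
  using assms unfolding tensor_product_def by (rule conjunct1)

lemma tensor_product_functional:
  assumes "tensor_product s1 s2 sT tens" "bilinear_map s1 s2 (*) f"
  shows "\<exists>!g. Vector_Spaces.linear sT (*) g \<and> (\<forall>u v. g (tens u v) = f u v)"
  by (rule mp[OF spec[OF conjunct2[OF assms(1)[unfolded tensor_product_def]], of f] assms(2)])

lemma tensor_product_span:
  assumes "tensor_product s1 s2 sT tens"
  shows "module.span sT {tens u v | u v. True} = UNIV"
proof (rule ccontr)
  let ?P = "{tens u v | u v. True}"
  assume neq: "module.span sT ?P \<noteq> UNIV"
  note vs = bilinear_map_vector_spaces[OF tensor_product_bilinear[OF assms]]
  interpret T: vector_space sT by fact
  interpret TK: vector_space_pair sT "(*)"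
    using vs vector_space_field by (simp add: vector_space_pair_def)
  interpret UK: vector_space_pair s1 "(*)"
    using vs vector_space_field by (simp add: vector_space_pair_def)
  interpret VK: vector_space_pair s2 "(*)"
    using vs vector_space_field by (simp add: vector_space_pair_def)
  obtain x where x: "x \<notin> T.span ?P" using neq by auto
  obtain B where B: "B \<subseteq> ?P" "T.independent B" "?P \<subseteq> T.span B"
    by (rule T.maximal_independent_subset)
  have "x \<notin> T.span B" using x B(1) T.span_mono by blast
  then obtain \<phi> where \<phi>: "Vector_Spaces.linear sT (*) \<phi>" "\<forall>b\<in>B. \<phi> b = 0" "\<phi> x = 1"
    using functional_separates[OF vs(3) B(2)] by blast
  have 0: "Vector_Spaces.linear sT (*) (\<lambda>_. 0)" by (rule TK.linear_zero)
  have P0: "\<phi> p = 0" if "p \<in> ?P" for p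
    using TK.linear_eq_on[OF \<phi>(1) 0, of p B] that B(3) \<phi>(2) by blast
  have "bilinear_map s1 s2 (*) (\<lambda>_ _. 0)"
    by (simp add: bilinear_map_def UK.linear_zero VK.linear_zero)
  then have "\<exists>!g. Vector_Spaces.linear sT (*) g \<and> (\<forall>u v. g (tens u v) = 0)"
    by (rule tensor_product_functional[OF assms])
  moreover have "\<forall>u v. \<phi> (tens u v) = 0" using P0 by blast
  ultimately have "\<phi> = (\<lambda>_. 0)" using \<phi>(1) 0 by blast
  then show False using \<phi>(3) by simp
qed

theorem tensor_product_universal:
  assumes tp: "tensor_product s1 s2 sT tens" and f: "bilinear_map s1 s2 s3 f"
  shows "\<exists>!g. Vector_Spaces.linear sT s3 g \<and> (\<forall>u v. g (tens u v) = f u v)"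
proof -
  let ?P = "{tens u v | u v. True}"
  have vs: "vector_space sT" "vector_space s3"
    using bilinear_map_vector_spaces[OF tensor_product_bilinear[OF tp]]
      bilinear_map_vector_spaces[OF f] by simp_all
  interpret T: vector_space sT by fact
  interpret W: vector_space s3 by fact
  interpret TW: vector_space_pair sT s3 using vs by (simp add: vector_space_pair_def)
  interpret TK: vector_space_pair sT "(*)"
    using vs vector_space_field by (simp add: vector_space_pair_def)
  interpret WK: vector_space_pair s3 "(*)"
    using vs vector_space_field by (simp add: vector_space_pair_def)
  have span: "T.span ?P = UNIV" using tensor_product_span[OF tp] .
  obtain B where B: "B \<subseteq> ?P" "T.independent B" "?P \<subseteq> T.span B"
    by (rule T.maximal_independent_subset)
  have spanB: "T.span B = UNIV" using T.span_mono[OF B(3)] span by (auto simp: T.span_span)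
  have "\<forall>b\<in>B. \<exists>w. \<exists>u v. b = tens u v \<and> w = f u v" using B(1) by blast
  from bchoice[OF this] obtain h where h: "\<forall>b\<in>B. \<exists>u v. b = tens u v \<and> h b = f u v"
    by (rule exE)
  obtain g where g: "Vector_Spaces.linear sT s3 g" "\<forall>b\<in>B. g b = h b"
    using TW.linear_independent_extend[OF B(2), of h] by blast
  have gt: "g (tens u v) = f u v" for u v
  proof (rule ccontr)
    assume ne: "g (tens u v) \<noteq> f u v"
    then have "g (tens u v) - f u v \<notin> W.span {}" by simp
    then obtain \<phi> where \<phi>: "Vector_Spaces.linear s3 (*) \<phi>" "\<phi> (g (tens u v) - f u v) = 1"
      using functional_separates[OF vs(2) W.independent_empty] by blast
    have "bilinear_map s1 s2 (*) (\<lambda>u v. \<phi> (f u v))"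
      unfolding bilinear_map_def
    proof (intro conjI allI)
      fix x show "Vector_Spaces.linear s2 (*) (\<lambda>v. \<phi> (f x v))"
        using Vector_Spaces.linear_compose[OF _ \<phi>(1), of s2 "f x"] f
        by (simp add: bilinear_map_def o_def)
    next
      fix y show "Vector_Spaces.linear s1 (*) (\<lambda>u. \<phi> (f u y))"
        using Vector_Spaces.linear_compose[OF _ \<phi>(1), of s1 "\<lambda>u. f u y"] f
        by (simp add: bilinear_map_def o_def)
    qed
    then have "\<exists>!k. Vector_Spaces.linear sT (*) k \<and> (\<forall>u v. k (tens u v) = \<phi> (f u v))"
      by (rule tensor_product_functional[OF tp])
    then obtain k where k: "Vector_Spaces.linear sT (*) k" "\<And>u v. k (tens u v) = \<phi> (f u v)"
      by blast
    have "Vector_Spaces.linear sT (*) (\<lambda>x. \<phi> (g x))"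
      using Vector_Spaces.linear_compose[OF g(1) \<phi>(1)] by (simp add: o_def)
    moreover have "\<phi> (g b) = k b" if "b \<in> B" for b
    proof -
      obtain u v where "b = tens u v" "h b = f u v" using h \<open>b \<in> B\<close> by blast
      then show ?thesis using g(2) k(2)[of u v] \<open>b \<in> B\<close> by simp
    qed
    ultimately have "\<phi> (g (tens u v)) = k (tens u v)"
      using TK.linear_eq_on[of "\<lambda>x. \<phi> (g x)" k "tens u v" B] k(1) spanB by simp
    then have "\<phi> (g (tens u v)) = \<phi> (f u v)" using k(2) by simp
    moreover have "\<phi> (g (tens u v) - f u v) = \<phi> (g (tens u v)) - \<phi> (f u v)"
      using WK.linear_diff[OF \<phi>(1)] .
    ultimately show False using \<phi>(2) by simp
  qed
  show ?thesis
  proof (rule ex1I[of _ g])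
    fix g' assume g': "Vector_Spaces.linear sT s3 g' \<and> (\<forall>u v. g' (tens u v) = f u v)"
    show "g' = g"
    proof
      fix x show "g' x = g x"
      proof (rule TW.linear_eq_on[of g' g x ?P])
        show "x \<in> T.span ?P" by (simp only: span UNIV_I)
      next
        fix b assume "b \<in> ?P"
        then obtain u v where "b = tens u v" by blast
        then show "g' b = g b" using g' gt by simp
      qed (use g' g in simp_all)
    qed
  qed (use g gt in auto)
qed

end

theory Submission
  imports Defs
begin

text \<open>In an associative LR-algebra every product of three factors is independent of their order.
  Writing \<open>S\<close> and \<open>B\<close> for the symmetrised product and the commutator, the operations induced on the
  tensor product are
  \<open>[u \<otimes> a, v \<otimes> b] = S u v \<otimes> (ab - ba) + 2 B u v \<otimes> (ab + ba)\<close> and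
  \<open>(u \<otimes> a) \<circ> (v \<otimes> b) = S u v \<otimes> (ab + ba) + 1/4 B u v \<otimes> (ab - ba)\<close>.
  In any twofold product the terms with \<open>ab - ba\<close> vanish, so each Poisson identity reduces to
  the same identity in \<open>A\<close>, tensored with \<open>abc\<close>. Every Poisson admissible product is
  quasi-canonical. It is strongly so if and only if each left multiplication \<open>L\<^sub>z\<close> with \<open>z\<close> in
  \<open>[A,[A,A]]\<close> equals some \<open>ad\<^sub>y\<close> with \<open>y\<close> in \<open>[A,A]\<close>, and then left multiplication by
  \<open>z \<otimes> abc\<close> is \<open>ad\<close> of \<open>1/4 (2 y + z) \<otimes> abc\<close>.\<close>

section \<open>Bilinear maps and linear functionals\<close>

text \<open>Linear functionals turn vector identities into identities in the field, where
  \<open>field_simps\<close> collects the scalar coefficients.\<close>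

lemma vector_eqI_functional:
  assumes "vector_space s"
    and eq: "\<And>\<phi>. \<lbrakk>\<And>x y. \<phi> (x + y) = \<phi> x + \<phi> y; \<And>x y. \<phi> (x - y) = \<phi> x - \<phi> y; \<And>x. \<phi> (- x) = - \<phi> x;
      \<phi> 0 = 0; \<And>c x. \<phi> (s c x) = c * \<phi> x\<rbrakk> \<Longrightarrow> \<phi> x = \<phi> y"
  shows "x = y"
proof (rule ccontr)
  assume ne: "x \<noteq> y"
  interpret vector_space_pair s "(*)"
    using assms(1) vector_space_field by (simp add: vector_space_pair_def)
  \<comment> \<open>\<open>span {}\<close> is the zero space, so \<open>functional_separates\<close>
    gives a functional with value 1 at \<open>x - y\<close>.\<close>
  from ne have "x - y \<notin> vs1.span {}" by simp
  then obtain \<phi> where \<phi>: "Vector_Spaces.linear s (*) \<phi>" "\<phi> (x - y) = 1"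
    using functional_separates[OF assms(1) vs1.independent_empty] by blast
  have "\<phi> x = \<phi> y"
    by (rule eq) (use \<phi>(1) in \<open>simp_all add: linear_add linear_diff linear_neg linear_0 linear_scale\<close>)
  then show False using \<phi>(2) linear_diff[OF \<phi>(1), of x y] by simp
qed

lemma bilinear_map_iff:
  "bilinear_map s1 s2 s3 f \<longleftrightarrow> vector_space s1 \<and> vector_space s2 \<and> vector_space s3 \<and>
     (\<forall>x y z. f (x + y) z = f x z + f y z) \<and> (\<forall>x y z. f x (y + z) = f x y + f x z) \<and>
     (\<forall>c x y. f (s1 c x) y = s3 c (f x y)) \<and> (\<forall>c x y. f x (s2 c y) = s3 c (f x y))"
  unfolding bilinear_map_def Vector_Spaces.linear_iff by auto

lemma bilinear_mapD:
  assumes "bilinear_map s1 s2 s3 f"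
  shows "f (x + y) z = f x z + f y z" "f x (v + w) = f x v + f x w"
    and "f (s1 c x) z = s3 c (f x z)" "f x (s2 c v) = s3 c (f x v)"
    and "f 0 z = 0" "f x 0 = 0" "f (- x) z = - f x z" "f x (- v) = - f x v"
    and "f (x - y) z = f x z - f y z" "f x (v - w) = f x v - f x w"
proof -
  interpret L: Vector_Spaces.linear s1 s3 "\<lambda>x. f x z" for z
    using assms by (simp add: bilinear_map_def)
  interpret R: Vector_Spaces.linear s2 s3 "f x" for x
    using assms by (simp add: bilinear_map_def)
  show "f (x + y) z = f x z + f y z" "f x (v + w) = f x v + f x w"
    "f (s1 c x) z = s3 c (f x z)" "f x (s2 c v) = s3 c (f x v)"
    "f 0 z = 0" "f x 0 = 0" "f (- x) z = - f x z" "f x (- v) = - f x v"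
    "f (x - y) z = f x z - f y z" "f x (v - w) = f x v - f x w"
    by (simp_all add: L.add R.add L.scale R.scale L.zero R.zero L.neg R.neg L.diff R.diff)
qed

lemma algebra_over_commutator:
  assumes "algebra_over s m"
  shows "algebra_over s (commutator m)"
proof -
  interpret vector_space s
    using assms by (simp add: algebra_over_def bilinear_map_iff)
  show ?thesis
    using assms unfolding algebra_over_def bilinear_map_iff commutator_def
    by (simp add: scale_right_diff_distrib)
qed

lemma algebra_over_sym_product:
  assumes "algebra_over s m"
  shows "algebra_over s (sym_product s m)"
proof -
  interpret vector_space s
    using assms by (simp add: algebra_over_def bilinear_map_iff)
  show ?thesis
    using assms unfolding algebra_over_def bilinear_map_iff sym_product_def
    by (simp add: scale_right_distrib scale_left_commute add.assoc add.left_commute)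
qed

lemma product_eq_sym_product_plus_commutator:
  fixes s :: "'k::field_char_0 \<Rightarrow> 'v::ab_group_add \<Rightarrow> 'v"
  assumes "vector_space s"
  shows "m u v = sym_product s m u v + s (1/2) (commutator m u v)"
  by (rule vector_eqI_functional[OF assms])
    (simp add: sym_product_def commutator_def; simp add: field_simps)

text \<open>Substitute \<open>m = S + 1/2 B\<close>. Bi-invariance holds because \<open>B u\<close>
  is a derivation of both \<open>S\<close> and \<open>B\<close>. In the curvature the terms with two
  \<open>S\<close> cancel since left \<open>S\<close>-multiplications commute, the mixed terms sum
  to \<open>S (B u v) w\<close> and cancel against the \<open>S\<close>-part of
  \<open>m (B u v) w\<close>, and the \<open>B\<close>-terms leave 1/4 - 1/2 = -1/4.\<close>

lemma poisson_admissible_quasi_canonical: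
  fixes s :: "'k::field_char_0 \<Rightarrow> 'v::ab_group_add \<Rightarrow> 'v"
  assumes "poisson_admissible s m"
  shows "quasi_canonical s (commutator m) m"
proof -
  define B where "B = commutator m"
  define S where "S = sym_product s m"
  have poisson: "algebra_over s m" "poisson_algebra s B S"
    using assms by (simp_all add: poisson_admissible_def B_def S_def)
  have vs: "vector_space s"
    using poisson by (simp add: algebra_over_def bilinear_map_iff)
  interpret vector_space s by fact
  have m: "m u v = S u v + s (1/2) (B u v)" for u v
    unfolding S_def B_def by (rule product_eq_sym_product_plus_commutator[OF vs])
  have bilB: "bilinear_map s s s B" and bilS: "bilinear_map s s s S"
    using poisson
    by (simp_all add: poisson_algebra_def lie_algebra_def associative_algebra_def algebra_over_def)
  note bil = bilinear_mapD[OF bilB] bilinear_mapD[OF bilS]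
  have antisym: "B u v = - B v u" for u v
    by (simp add: B_def commutator_def)
  have leibniz: "B u (S v w) = S (B u v) w + S v (B u w)"
    and assoc: "S (S u v) w = S u (S v w)" for u v w
    using poisson unfolding poisson_algebra_def associative_algebra_def by blast+
  have comm: "S u v = S v u" for u v
    using poisson unfolding poisson_algebra_def by blast
  have jacobi: "B u (B v w) = B (B u v) w + B v (B u w)" for u v w
  proof -
    have "B u (B v w) + B v (B w u) + B w (B u v) = 0"
      using poisson by (simp add: poisson_algebra_def lie_algebra_def)
    moreover have "B v (B w u) = - B v (B u w)"
      by (simp add: antisym[of w u] bil)
    moreover have "B w (B u v) = - B (B u v) w"
      by (rule antisym)
    ultimately show ?thesis by (simp add: algebra_simps)
  qed
  have lcomm: "S u (S v w) = S v (S u w)" for u v w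
    by (metis assoc comm)
  show ?thesis
    unfolding quasi_canonical_def B_def[symmetric]
  proof (intro conjI allI)
    show "finite_dimensional s" "lie_algebra s B" "algebra_over s m"
      using poisson by (simp_all add: poisson_algebra_def)
    show "m u v - m v u = B u v" for u v
      by (simp add: B_def commutator_def)
    show "B u (m v w) = m (B u v) w + m v (B u w)" for u v w
      by (simp add: m bil leibniz jacobi[of u v w] scale_right_distrib)
    show "curvature B m u v = (\<lambda>w. s (- (1/4)) (left_mult B (B u v) w))" for u v
    proof
      fix w
      \<comment> \<open>Fixed instances orient the rewriting: the general \<open>jacobi\<close>
        would apply again to its own right-hand side.\<close>
      show "curvature B m u v w = s (- (1/4)) (left_mult B (B u v) w)"
        by (rule vector_eqI_functional[OF vs])
          (simp add: curvature_def op_commutator_def left_mult_def m bil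
            leibniz jacobi[of u v w] antisym[of v u] lcomm[of v u w]; simp add: field_simps)
    qed
  qed
qed

section \<open>Maps out of tensor products\<close>

text \<open>Pure tensors span, and a scalar can be absorbed into the left factor of a pure tensor,
  so every tensor is a finite sum of pure ones and the induction has no scalar case.\<close>

lemma tensor_product_induct:
  assumes tp: "tensor_product s1 s2 sT tens"
    and pure: "\<And>u a. P (tens u a)" and add: "\<And>x y. \<lbrakk>P x; P y\<rbrakk> \<Longrightarrow> P (x + y)"
  shows "P x"
proof -
  note bil = tensor_product_bilinear[OF tp]
  interpret vector_space sT using bil by (simp add: bilinear_map_iff)
  have "x \<in> span {tens u v | u v. True}"
    using tensor_product_span[OF tp] by simp
  then show ?thesis
  proof (induction rule: span_induct_alt)
    case base
    then show ?case using pure[of 0 0] by (simp add: bilinear_mapD[OF bil])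
  next
    case (step c x y)
    then obtain u a where "x = tens u a" by blast
    then have "sT c x = tens (s1 c u) a" by (simp add: bilinear_mapD[OF bil])
    then show ?case using step add pure by simp
  qed
qed

text \<open>The pure tensors of basis vectors form a finite spanning set; a maximal independent
  subset of it is a basis.\<close>

lemma tensor_product_finite_dimensional:
  assumes tp: "tensor_product s1 s2 sT tens"
    and "finite_dimensional s1" "finite_dimensional s2"
  shows "finite_dimensional sT"
proof -
  note bil = tensor_product_bilinear[OF tp]
  interpret T: vector_space sT using bil by (simp add: bilinear_map_iff)
  obtain B1 B2 where B: "finite_dimensional_vector_space s1 B1" "finite_dimensional_vector_space s2 B2"
    using assms by (auto simp: finite_dimensional_def)
  interpret V1: finite_dimensional_vector_space s1 B1 by fact
  interpret V2: finite_dimensional_vector_space s2 B2 by fact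
  let ?C = "(\<lambda>(u, v). tens u v) ` (B1 \<times> B2)"
  have "tens u v \<in> T.span ?C" if "u \<in> B1" for u v
  proof -
    have "v \<in> V2.span B2" using V2.span_Basis by simp
    then show ?thesis
    proof (induction rule: V2.span_induct_alt)
      case base
      then show ?case by (simp add: bilinear_mapD[OF bil] T.span_zero)
    next
      case (step c x y)
      then have "tens u x \<in> T.span ?C" using that by (auto intro!: T.span_base)
      with step show ?case
        by (simp add: bilinear_mapD[OF bil] T.span_add T.span_scale)
    qed
  qed
  then have pure: "tens u v \<in> T.span ?C" for u v
  proof -
    assume *: "\<And>u v. u \<in> B1 \<Longrightarrow> tens u v \<in> T.span ?C"
    have "u \<in> V1.span B1" using V1.span_Basis by simp
    then show ?thesis
      by (induction rule: V1.span_induct_alt)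
        (simp_all add: * bilinear_mapD[OF bil] T.span_add T.span_scale T.span_zero)
  qed
  have "T.span ?C = UNIV"
    using tensor_product_induct[OF tp, of "\<lambda>x. x \<in> T.span ?C"] pure T.span_add by auto
  moreover obtain D where D: "D \<subseteq> ?C" "T.independent D" "?C \<subseteq> T.span D"
    by (rule T.maximal_independent_subset)
  moreover have "finite D"
    using D(1) V1.finite_Basis V2.finite_Basis by (meson finite_SigmaI finite_imageI finite_subset)
  ultimately have "finite_dimensional_vector_space sT D"
    using T.span_mono[OF D(3)] by unfold_locales (auto simp: T.span_span)
  then show ?thesis by (auto simp: finite_dimensional_def)
qed

text \<open>The universal property is applied twice: \<open>G\<close> extends the second argument
  for a fixed pure first one, then \<open>H\<close> extends the first. \<open>H\<close> takes its
  arguments in swapped order.\<close>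

lemma tensor_product_bilinear_extension:
  assumes tp: "tensor_product s1 s2 sT tens" and vs3: "vector_space s3"
    and bil1: "\<And>v b. bilinear_map s1 s2 s3 (\<lambda>u a. F u a v b)"
    and bil2: "\<And>u a. bilinear_map s1 s2 s3 (F u a)"
  shows "\<exists>!f. bilinear_map sT sT s3 f \<and> (\<forall>u a v b. f (tens u a) (tens v b) = F u a v b)"
proof -
  have vsT: "vector_space sT"
    using tensor_product_bilinear[OF tp] by (simp add: bilinear_map_iff)
  interpret T: vector_space s3 by fact
  have "\<forall>u a. \<exists>g. Vector_Spaces.linear sT s3 g \<and> (\<forall>v b. g (tens v b) = F u a v b)"
    using tensor_product_universal[OF tp bil2] by blast
  then obtain G where G: "\<And>u a. Vector_Spaces.linear sT s3 (G u a)"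
      "\<And>u a v b. G u a (tens v b) = F u a v b"
    by metis
  have "bilinear_map s1 s2 s3 (\<lambda>u a. G u a y)" for y
  proof (induction y rule: tensor_product_induct[OF tp])
    case (1 v b)
    then show ?case using bil1 by (simp add: G)
  next
    case (2 x y)
    then show ?case
      using G(1) by (simp add: bilinear_map_iff Vector_Spaces.linear_iff
        T.scale_right_distrib add.assoc add.left_commute)
  qed
  then have "\<forall>y. \<exists>h. Vector_Spaces.linear sT s3 h \<and> (\<forall>u a. h (tens u a) = G u a y)"
    using tensor_product_universal[OF tp] by blast
  then obtain H where H: "\<And>y. Vector_Spaces.linear sT s3 (H y)"
      "\<And>y u a. H y (tens u a) = G u a y"
    by metis
  \<comment> \<open>Each \<open>H y\<close> is chosen separately, so linearity in \<open>y\<close>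
    is recovered by comparing values on pure tensors.\<close>
  have H_add: "H (y + z) x = H y x + H z x" for x y z
    by (induction x rule: tensor_product_induct[OF tp])
      (use G(1) H in \<open>simp_all add: Vector_Spaces.linear_iff add.assoc add.left_commute\<close>)
  have H_scale: "H (sT c y) x = s3 c (H y x)" for c x y
    by (induction x rule: tensor_product_induct[OF tp])
      (use G(1) H in \<open>simp_all add: Vector_Spaces.linear_iff T.scale_right_distrib\<close>)
  show ?thesis
  proof (rule ex1I[of _ "\<lambda>x y. H y x"])
    show "bilinear_map sT sT s3 (\<lambda>x y. H y x) \<and>
        (\<forall>u a v b. H (tens v b) (tens u a) = F u a v b)"
      using H G vsT vs3 H_add H_scale by (simp add: bilinear_map_iff Vector_Spaces.linear_iff)
  next
    fix f
    assume f: "bilinear_map sT sT s3 f \<and> (\<forall>u a v b. f (tens u a) (tens v b) = F u a v b)"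
    then have add: "f (x + y) z = f x z + f y z" "f x (y + z) = f x y + f x z" for x y z
      by (simp_all add: bilinear_map_iff)
    have "f x (tens v b) = H (tens v b) x" for x v b
      by (induction x rule: tensor_product_induct[OF tp])
        (use f H G add in \<open>simp_all add: Vector_Spaces.linear_iff\<close>)
    then have "f x y = H y x" for x y
      by (induction y rule: tensor_product_induct[OF tp]) (simp_all add: add H_add)
    then show "f = (\<lambda>x y. H y x)" by blast
  qed
qed

text \<open>Induction on one slot after another, with additivity as the induction step; this reduces
  the Poisson axioms to pure tensors.\<close>

lemma tensor_product_trilinear_eq:
  assumes tp: "tensor_product s1 s2 sT tens"
    and pure: "\<And>u a v b w c. f (tens u a) (tens v b) (tens w c) = g (tens u a) (tens v b) (tens w c)"
    and f: "\<And>x x' y z. f (x + x') y z = f x y z + f x' y z"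
      "\<And>x y y' z. f x (y + y') z = f x y z + f x y' z"
      "\<And>x y z z'. f x y (z + z') = f x y z + f x y z'"
    and g: "\<And>x x' y z. g (x + x') y z = g x y z + g x' y z"
      "\<And>x y y' z. g x (y + y') z = g x y z + g x y' z"
      "\<And>x y z z'. g x y (z + z') = g x y z + g x y z'"
  shows "f x y z = (g x y z :: 'w::ab_group_add)"
proof -
  have "f (tens u a) (tens v b) z = g (tens u a) (tens v b) z" for u a v b
    by (induction z rule: tensor_product_induct[OF tp]) (simp_all add: pure f g)
  then have "f (tens u a) y z = g (tens u a) y z" for u a
    by (induction y rule: tensor_product_induct[OF tp]) (simp_all add: f g)
  then show ?thesis
    by (induction x rule: tensor_product_induct[OF tp]) (simp_all add: f g)
qed

section \<open>The product on the tensor product\<close>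

text \<open>Here \<open>star\<close> is any bilinear product with the prescribed values on pure
  tensors; the final theorem constructs it.\<close>

locale LR_tensor_product =
  fixes sA :: "'k::field_char_0 \<Rightarrow> 'a::ab_group_add \<Rightarrow> 'a" and mA :: "'a \<Rightarrow> 'a \<Rightarrow> 'a"
    and sU :: "'k \<Rightarrow> 'u::ab_group_add \<Rightarrow> 'u" and mU :: "'u \<Rightarrow> 'u \<Rightarrow> 'u"
    and sT :: "'k \<Rightarrow> 't::ab_group_add \<Rightarrow> 't" and tens :: "'a \<Rightarrow> 'u \<Rightarrow> 't"
    and star :: "'t \<Rightarrow> 't \<Rightarrow> 't"
  assumes admissible: "poisson_admissible sA mA"
    and fin_dim: "finite_dimensional sU"
    and assoc_alg: "associative_algebra sU mU" and LR: "LR_algebra sU mU"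
    and tp: "tensor_product sA sU sT tens"
    and star_alg: "algebra_over sT star"
    and star_tens: "star (tens u a) (tens v b) =
           sT (1/2) (tens (commutator mA u v) (mU a b + mU b a)) +
           sT (1/2) (tens (mA u v) (sU 3 (mU a b) + mU b a))"
begin

abbreviation "B \<equiv> commutator mA"
abbreviation "S \<equiv> sym_product sA mA"
abbreviation "BT \<equiv> commutator star"
abbreviation "ST \<equiv> sym_product sT star"

section \<open>Products of several factors in the LR-algebra\<close>

lemma mU_assoc: "mU (mU a b) c = mU a (mU b c)"
  using assoc_alg by (simp add: associative_algebra_def)

lemma mU_left_commute: "mU a (mU b c) = mU b (mU a c)"
  using LR by (simp add: LR_algebra_def op_commutator_def left_mult_def fun_eq_iff)

lemma mU_right_commute: "mU a (mU b c) = mU a (mU c b)"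
  using LR by (simp add: LR_algebra_def op_commutator_def right_mult_def fun_eq_iff mU_assoc)

text \<open>The two commutation rules are adjacent transpositions, which generate all reorderings;
  used as ordered rewrite rules they bring products of three or more factors into one normal
  form.\<close>

lemmas mU_normalize = mU_assoc mU_left_commute mU_right_commute

lemma poisson: "poisson_algebra sA B S" and mA_alg: "algebra_over sA mA"
  using admissible by (simp_all add: poisson_admissible_def)

sublocale A: vector_space sA using mA_alg by (simp add: algebra_over_def bilinear_map_iff)
sublocale T: vector_space sT using star_alg by (simp add: algebra_over_def bilinear_map_iff)

lemmas bilinear =
  bilinear_mapD[OF mA_alg[unfolded algebra_over_def]]
  bilinear_mapD[OF algebra_over_commutator[OF mA_alg, unfolded algebra_over_def]]
  bilinear_mapD[OF algebra_over_sym_product[OF mA_alg, unfolded algebra_over_def]]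
  bilinear_mapD[OF assoc_alg[THEN associative_algebra_def[THEN iffD1], THEN conjunct1, unfolded algebra_over_def]]
  bilinear_mapD[OF tensor_product_bilinear[OF tp]]
  bilinear_mapD[OF star_alg[unfolded algebra_over_def]]
  bilinear_mapD[OF algebra_over_commutator[OF star_alg, unfolded algebra_over_def]]
  bilinear_mapD[OF algebra_over_sym_product[OF star_alg, unfolded algebra_over_def]]

lemma B_antisym: "B v u = - B u v"
  by (simp add: commutator_def)

lemma S_comm: "S v u = S u v"
  by (simp add: sym_product_def add.commute)

lemma S_assoc: "S (S u v) w = S u (S v w)"
  and leibniz: "B u (S v w) = S (B u v) w + S v (B u w)"
  and jacobi: "B u (B v w) + B v (B w u) + B w (B u v) = 0"
  using poisson unfolding poisson_algebra_def associative_algebra_def lie_algebra_def by blast+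

section \<open>Single and iterated products of pure tensors\<close>

lemma mA_eq: "mA u v = S u v + sA (1/2) (B u v)"
  by (rule product_eq_sym_product_plus_commutator) unfold_locales

text \<open>Insert \<open>mA_eq\<close>: the \<open>B\<close>-coefficients are 1/2 + 3/4 = 5/4 at
  \<open>mU a b\<close> and 1/2 + 1/4 = 3/4 at \<open>mU b a\<close>.\<close>

lemma star_tens_eq:
  "star (tens u a) (tens v b) = sT (3/2) (tens (S u v) (mU a b)) + sT (1/2) (tens (S u v) (mU b a))
     + sT (5/4) (tens (B u v) (mU a b)) + sT (3/4) (tens (B u v) (mU b a))"
  by (rule vector_eqI_functional[OF T.vector_space_axioms])
    (simp add: star_tens mA_eq bilinear; simp add: field_simps)

lemma BT_tens:
  "BT (tens u a) (tens v b) = tens (S u v) (mU a b - mU b a) + sT 2 (tens (B u v) (mU a b + mU b a))"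
  by (rule vector_eqI_functional[OF T.vector_space_axioms])
    (simp add: commutator_def[of star] star_tens_eq S_comm[of v u] B_antisym[of v u] bilinear;
      simp add: field_simps)

lemma ST_tens:
  "ST (tens u a) (tens v b) = tens (S u v) (mU a b + mU b a) + sT (1/4) (tens (B u v) (mU a b - mU b a))"
  by (rule vector_eqI_functional[OF T.vector_space_axioms])
    (simp add: sym_product_def[of sT star] star_tens_eq S_comm[of v u] B_antisym[of v u] bilinear;
      simp add: field_simps)

text \<open>The surviving symmetric terms expand to four equal products \<open>abc\<close>, and each
  \<open>BT\<close> contributes a factor 2: hence 2 * 2 * 4 = 16. The same count gives 4 and 8 in
  the next three lemmas.\<close>

lemma BT_BT_tens:
  "BT (tens u a) (BT (tens v b) (tens w c)) = sT 16 (tens (B u (B v w)) (mU a (mU b c)))"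
  by (rule vector_eqI_functional[OF T.vector_space_axioms])
    (simp add: BT_tens bilinear mU_normalize; simp add: field_simps)

lemma ST_ST_tens:
  "ST (tens u a) (ST (tens v b) (tens w c)) = sT 4 (tens (S u (S v w)) (mU a (mU b c)))"
  by (rule vector_eqI_functional[OF T.vector_space_axioms])
    (simp add: ST_tens bilinear mU_normalize; simp add: field_simps)

lemma BT_ST_tens:
  "BT (tens u a) (ST (tens v b) (tens w c)) = sT 8 (tens (B u (S v w)) (mU a (mU b c)))"
  by (rule vector_eqI_functional[OF T.vector_space_axioms])
    (simp add: ST_tens BT_tens bilinear mU_normalize; simp add: field_simps)

lemma ST_BT_tens:
  "ST (tens u a) (BT (tens v b) (tens w c)) = sT 8 (tens (S u (B v w)) (mU a (mU b c)))"
  by (rule vector_eqI_functional[OF T.vector_space_axioms])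
    (simp add: ST_tens BT_tens bilinear mU_normalize; simp add: field_simps)

section \<open>The Poisson axioms for \<open>star\<close>\<close>

lemma ST_comm: "ST x y = ST y x"
  by (simp add: sym_product_def add.commute)

lemma ST_assoc: "ST (ST x y) z = ST x (ST y z)"
proof -
  \<comment> \<open>By commutativity both sides are nested to the right, the shape that
    \<open>ST_ST_tens\<close> evaluates.\<close>
  have "ST z (ST x y) = ST x (ST y z)"
  proof (rule tensor_product_trilinear_eq[OF tp, where f = "\<lambda>x y z. ST z (ST x y)"])
    fix u a v b w c
    have "S w (S u v) = S u (S v w)" by (metis S_assoc S_comm)
    then show "ST (tens w c) (ST (tens u a) (tens v b)) = ST (tens u a) (ST (tens v b) (tens w c))"
      by (simp add: ST_ST_tens mU_normalize)
  qed (simp_all add: bilinear)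
  then show ?thesis by (simp add: ST_comm[of _ z])
qed

text \<open>The term \<open>ST z (BT x y)\<close> is nested to the right to match
  \<open>ST_BT_tens\<close>; \<open>ST_comm\<close> later restores the usual form.\<close>

lemma BT_leibniz: "BT x (ST y z) = ST z (BT x y) + ST y (BT x z)"
proof (rule tensor_product_trilinear_eq[OF tp, where f = "\<lambda>x y z. BT x (ST y z)"])
  fix u a v b w c
  show "BT (tens u a) (ST (tens v b) (tens w c)) =
      ST (tens w c) (BT (tens u a) (tens v b)) + ST (tens v b) (BT (tens u a) (tens w c))"
    by (simp add: BT_ST_tens ST_BT_tens leibniz S_comm[of w] bilinear mU_normalize T.scale_right_distrib)
qed (simp_all add: bilinear)

lemma BT_jacobi: "BT x (BT y z) + BT y (BT z x) + BT z (BT x y) = 0"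
proof (rule tensor_product_trilinear_eq[OF tp,
    where f = "\<lambda>x y z. BT x (BT y z) + BT y (BT z x) + BT z (BT x y)" and g = "\<lambda>_ _ _. 0"])
  fix u a v b w c
  \<comment> \<open>All three terms share the scalar 16 and, after normalization, the same factor
    \<open>d = abc\<close>, so Jacobi in the first factor suffices.\<close>
  have "tens (B u (B v w) + B v (B w u) + B w (B u v)) d = 0" for d
    by (simp only: jacobi bilinear)
  then have "sT 16 (tens (B u (B v w)) d) + sT 16 (tens (B v (B w u)) d) + sT 16 (tens (B w (B u v)) d) = 0" for d
    by (simp add: bilinear flip: T.scale_right_distrib)
  then show "BT (tens u a) (BT (tens v b) (tens w c)) + BT (tens v b) (BT (tens w c) (tens u a)) +
      BT (tens w c) (BT (tens u a) (tens v b)) = 0"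
    by (simp add: BT_BT_tens mU_normalize)
qed (simp_all add: bilinear)

lemma poisson_admissible_star: "poisson_admissible sT star"
proof -
  have "finite_dimensional sT"
    using tensor_product_finite_dimensional[OF tp _ fin_dim] poisson by (simp add: poisson_algebra_def)
  moreover have "BT x x = 0" for x
    by (simp add: commutator_def)
  moreover have "BT x (ST y z) = ST (BT x y) z + ST y (BT x z)" for x y z
    using BT_leibniz ST_comm by metis
  ultimately show ?thesis
    unfolding poisson_admissible_def poisson_algebra_def lie_algebra_def associative_algebra_def
    using star_alg algebra_over_commutator algebra_over_sym_product ST_assoc ST_comm BT_jacobi by blast
qed

section \<open>Derived algebra and holonomy of \<open>star\<close>\<close>

lemma tens_derived:
  assumes "u \<in> derived_algebra sA B"
  shows "tens u (mU a (mU b c)) \<in> derived_algebra sT BT"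
proof -
  let ?D = "{BT x y | x y. x \<in> UNIV \<and> y \<in> UNIV}"
  have base: "tens (B p q) (mU a (mU b c)) \<in> T.span ?D" for p q
  proof -
    \<comment> \<open>Since \<open>(ab)c = c(ab)\<close>, the \<open>S\<close>-term of this bracket
      vanishes and the \<open>B\<close>-term is doubled.\<close>
    have "BT (tens p (mU a b)) (tens q c) = sT 4 (tens (B p q) (mU a (mU b c)))"
      by (rule vector_eqI_functional[OF T.vector_space_axioms])
        (simp add: BT_tens bilinear mU_normalize; simp add: field_simps)
    moreover have "BT (tens p (mU a b)) (tens q c) \<in> T.span ?D"
      by (blast intro: T.span_base)
    ultimately show ?thesis
      using T.span_scale[of "BT (tens p (mU a b)) (tens q c)" ?D "1/4"] by simp
  qed
  have "u \<in> A.span {B x y | x y. x \<in> UNIV \<and> y \<in> UNIV}"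
    using assms by (simp add: derived_algebra_def bracket_span_def)
  then have "tens u (mU a (mU b c)) \<in> T.span ?D"
    by (induction rule: A.span_induct_alt)
      (use base in \<open>auto simp: bilinear intro!: T.span_add T.span_scale T.span_zero\<close>)
  then show ?thesis by (simp add: derived_algebra_def bracket_span_def)
qed

text \<open>With \<open>p = abc\<close> one has \<open>pd = dp\<close>, so the left side at
  \<open>tens w d\<close> is \<open>2 (S z w + B z w)\<close> tensored with \<open>pd\<close>. As
  \<open>S z w = B y w - 1/2 B z w\<close>, this is \<open>B (2y + z) w\<close> tensored with
  \<open>pd\<close>, whereas bracketing \<open>tens x p\<close> with \<open>tens w d\<close> gives
  \<open>4 B x w\<close>; hence the factor 1/4.\<close>

lemma star_eq_BT_tens:
  assumes z: "\<And>w. mA z w = B y w"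
  shows "star (tens z (mU a (mU b c))) x = BT (sT (1/4) (tens (sA 2 y + z) (mU a (mU b c)))) x"
proof (induction x rule: tensor_product_induct[OF tp])
  case (1 w d)
  have S: "S z w = B y w - sA (1/2) (B z w)"
    using z[of w] mA_eq[of z w] by (simp add: algebra_simps)
  show ?case
    by (rule vector_eqI_functional[OF T.vector_space_axioms])
      (simp add: star_tens_eq BT_tens S bilinear mU_normalize; simp add: field_simps)
qed (simp add: bilinear)

lemma strongly_quasi_canonical_star:
  assumes "strongly_quasi_canonical sA B mA"
  shows "strongly_quasi_canonical sT BT star"
proof -
  let ?DA = "derived_algebra sA B" and ?DT = "derived_algebra sT BT"
  have subspaces: "A.subspace ?DA" "T.subspace ?DT"
    by (simp_all add: derived_algebra_def bracket_span_def)
  have A: "\<exists>y\<in>?DA. \<forall>w. mA z w = B y w" if "z \<in> bracket_span sA B UNIV ?DA" for z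
  proof -
    \<comment> \<open>The zero \<open>ad\<close>-part isolates \<open>mA z\<close> inside the
      holonomy algebra.\<close>
    have "(\<lambda>w. left_mult B 0 w + left_mult mA z w) \<in> holonomy_algebra sA B mA"
      unfolding holonomy_algebra_def using that A.subspace_0[OF subspaces(1)] by blast
    then have "(\<lambda>w. mA z w) \<in> left_mult B ` ?DA"
      using assms by (simp add: strongly_quasi_canonical_def left_mult_def bilinear)
    then show ?thesis by (auto simp: left_mult_def fun_eq_iff)
  qed
  \<comment> \<open>The goal reduces to \<open>bracket_span sT BT UNIV ?DT \<subseteq> G\<close>. As
    \<open>G\<close> is a subspace, it is enough to place double brackets of pure tensors in
    it.\<close>
  define G where "G = {z. \<exists>y\<in>?DT. \<forall>x. star z x = BT y x}"
  have G: "T.subspace G"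
  proof (rule T.subspaceI)
    show "0 \<in> G"
      using T.subspace_0[OF subspaces(2)] by (auto simp: G_def bilinear intro!: bexI[of _ 0])
  next
    fix x y assume "x \<in> G" "y \<in> G"
    then obtain x' y' where "x' \<in> ?DT" "y' \<in> ?DT" "\<forall>w. star x w = BT x' w" "\<forall>w. star y w = BT y' w"
      by (auto simp: G_def)
    then show "x + y \<in> G"
      using T.subspace_add[OF subspaces(2)] by (auto simp: G_def bilinear intro!: bexI[of _ "x' + y'"])
  next
    fix c x assume "x \<in> G"
    then obtain x' where "x' \<in> ?DT" "\<forall>w. star x w = BT x' w"
      by (auto simp: G_def)
    then show "sT c x \<in> G"
      using T.subspace_scale[OF subspaces(2)] by (auto simp: G_def bilinear intro!: bexI[of _ "sT c x'"])
  qed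
  have pure: "tens (B u (B v w)) (mU a (mU b c)) \<in> G" for u v w a b c
  proof -
    let ?z = "B u (B v w)"
    have "B v w \<in> ?DA"
      unfolding derived_algebra_def bracket_span_def by (rule A.span_base) blast
    then have z: "?z \<in> bracket_span sA B UNIV ?DA" "?z \<in> ?DA"
      unfolding derived_algebra_def bracket_span_def by (blast intro: A.span_base)+
    obtain y where y: "y \<in> ?DA" "\<And>w. mA ?z w = B y w" using A[OF z(1)] by blast
    \<comment> \<open>Both \<open>y\<close> and \<open>?z\<close> lie in the derived algebra, so
      \<open>tens_derived\<close> applies to \<open>2y + ?z\<close>.\<close>
    have "sT (1/4) (tens (sA 2 y + ?z) (mU a (mU b c))) \<in> ?DT"
      using y(1) z(2) subspaces
      by (intro T.subspace_scale tens_derived A.subspace_add A.subspace_scale)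
    then show ?thesis
      unfolding G_def using star_eq_BT_tens[OF y(2)] by blast
  qed
  have "BT (tens u a) (BT (tens v b) z) \<in> G" for u a v b z
    by (induction z rule: tensor_product_induct[OF tp])
      (simp_all add: BT_BT_tens pure T.subspace_scale[OF G] bilinear T.subspace_add[OF G])
  then have "BT (tens u a) (BT y z) \<in> G" for u a y z
    by (induction y rule: tensor_product_induct[OF tp]) (simp_all add: bilinear T.subspace_add[OF G])
  then have triple: "BT x (BT y z) \<in> G" for x y z
    by (induction x rule: tensor_product_induct[OF tp]) (simp_all add: bilinear T.subspace_add[OF G])
  have "BT x d \<in> G" if "d \<in> ?DT" for x d
    using that unfolding derived_algebra_def bracket_span_def
    by (induction rule: T.span_induct_alt)
      (auto simp: bilinear triple intro!: T.subspace_add[OF G] T.subspace_scale[OF G] T.subspace_0[OF G])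
  then have sub: "bracket_span sT BT UNIV ?DT \<subseteq> G"
    unfolding bracket_span_def by (intro T.span_minimal[OF _ G]) blast
  have "holonomy_algebra sT BT star = left_mult BT ` ?DT"
  proof
    show "holonomy_algebra sT BT star \<subseteq> left_mult BT ` ?DT"
    proof
      fix f assume "f \<in> holonomy_algebra sT BT star"
      then obtain u v where f: "f = (\<lambda>w. BT u w + star v w)" "u \<in> ?DT" "v \<in> G"
        using sub by (auto simp: holonomy_algebra_def left_mult_def)
      then obtain y where y: "y \<in> ?DT" "\<forall>w. star v w = BT y w"
        by (auto simp: G_def)
      \<comment> \<open>The summand \<open>star v\<close> is itself an \<open>ad\<close>, and
        \<open>ad\<close> is additive.\<close>
      then have "f = left_mult BT (u + y)"
        using f by (simp add: left_mult_def bilinear fun_eq_iff)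
      then show "f \<in> left_mult BT ` ?DT"
        using f(2) y(1) T.subspace_add[OF subspaces(2)] by blast
    qed
  next
    show "left_mult BT ` ?DT \<subseteq> holonomy_algebra sT BT star"
    proof
      fix f assume "f \<in> left_mult BT ` ?DT"
      then obtain u where "u \<in> ?DT" "f = left_mult BT u" by blast
      moreover have "0 \<in> bracket_span sT BT UNIV ?DT"
        by (simp add: bracket_span_def T.span_zero)
      moreover have "left_mult BT u = (\<lambda>w. left_mult BT u w + left_mult star 0 w)" for u
        by (simp add: left_mult_def bilinear)
      ultimately show "f \<in> holonomy_algebra sT BT star"
        unfolding holonomy_algebra_def by blast
    qed
  qed
  then show ?thesis
    using poisson_admissible_quasi_canonical[OF poisson_admissible_star]
    by (simp add: strongly_quasi_canonical_def)
qed

end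

section \<open>Construction of \<open>star\<close> and transfer of both properties\<close>

theorem theorem3p2:
  fixes sA :: "'k::field_char_0 \<Rightarrow> 'a::ab_group_add \<Rightarrow> 'a" and mA :: "'a \<Rightarrow> 'a \<Rightarrow> 'a"
    and sU :: "'k \<Rightarrow> 'u::ab_group_add \<Rightarrow> 'u" and mU :: "'u \<Rightarrow> 'u \<Rightarrow> 'u"
    and sT :: "'k \<Rightarrow> 't::ab_group_add \<Rightarrow> 't" and tens :: "'a \<Rightarrow> 'u \<Rightarrow> 't"
  assumes "poisson_admissible sA mA"
    and "finite_dimensional sU" and "associative_algebra sU mU" and "LR_algebra sU mU"
    and "tensor_product sA sU sT tens"
  shows "\<exists>star.
    (\<forall>star'. (algebra_over sT star' \<and>
        (\<forall>u a v b. star' (tens u a) (tens v b) =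
           sT (1/2) (tens (commutator mA u v) (mU a b + mU b a)) +
           sT (1/2) (tens (mA u v) (sU 3 (mU a b) + mU b a)))) \<longleftrightarrow> star' = star) \<and>
    poisson_admissible sT star \<and>
    (strongly_quasi_canonical sA (commutator mA) mA \<longrightarrow>
       strongly_quasi_canonical sT (commutator star) star)"
proof -
  let ?F = "\<lambda>u a v b. sT (1/2) (tens (commutator mA u v) (mU a b + mU b a)) +
     sT (1/2) (tens (mA u v) (sU 3 (mU a b) + mU b a))"
  have algs: "algebra_over sA mA" "algebra_over sU mU"
    using assms by (simp_all add: poisson_admissible_def associative_algebra_def)
  note bil = bilinear_mapD[OF algs(1)[unfolded algebra_over_def]]
    bilinear_mapD[OF algebra_over_commutator[OF algs(1), unfolded algebra_over_def]]
    bilinear_mapD[OF algs(2)[unfolded algebra_over_def]]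
    bilinear_mapD[OF tensor_product_bilinear[OF assms(5)]]
  have vs: "vector_space sA" "vector_space sU" "vector_space sT"
    using tensor_product_bilinear[OF assms(5)] by (simp_all add: bilinear_map_iff)
  have "bilinear_map sA sU sT (\<lambda>u a. ?F u a v b)" for v b
    unfolding bilinear_map_iff
    by (intro conjI vs allI; rule vector_eqI_functional[OF vs(3)]; simp add: bil; simp add: field_simps)
  moreover have "bilinear_map sA sU sT (?F u a)" for u a
    unfolding bilinear_map_iff
    by (intro conjI vs allI; rule vector_eqI_functional[OF vs(3)]; simp add: bil; simp add: field_simps)
  \<comment> \<open>Unique existence is what the biconditional with \<open>star' = star\<close> in
    the conclusion expresses.\<close>
  ultimately have ex1: "\<exists>!star. algebra_over sT star \<and>
      (\<forall>u a v b. star (tens u a) (tens v b) = ?F u a v b)"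
    unfolding algebra_over_def
    by (rule tensor_product_bilinear_extension[OF assms(5) vs(3), of ?F])
  then obtain star where star: "algebra_over sT star"
      "\<And>u a v b. star (tens u a) (tens v b) = ?F u a v b"
    by blast
  interpret LR_tensor_product sA mA sU mU sT tens star
    using assms star by unfold_locales
  show ?thesis
    using ex1 star poisson_admissible_star strongly_quasi_canonical_star
    by (intro exI[of _ star]) blast
qed

end
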